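(* Let $A=M^TM$ with $M\in\mathbb{R}^{m\times d}$, let $\lambda_1\ge\lambda_2\ge\dots\ge\lambda_d$ be the eigenvalues of $A$, and assume $\delta=\lambda_1-\lambda_2>0$. Let $v_1$ be a unit eigenvector of $A$ for $\lambda_1$, put $x^*=v_1$, and let $f:\mathbb{S}^{d-1}\to\mathbb{R}$, $f(x)=-x^TAx$. Let $a>0$, $B_a=\{x\in\mathbb{S}^{d-1}:\langle x,v_1\rangle\ge a\}$, let $\gamma\ge2\lambda_1$ and $0<\eta\le a/\gamma$. If $x^{(t)}\in B_a$ and $x^{(t+1)}=\exp_{x^{(t)}}\big(-\eta\,\mathrm{grad}f(x^{(t)})\big)$, then $$\mathrm{dist}^2(x^{(t+1)},x^* )\le(1-a\mu\eta)\,\mathrm{dist}^2(x^{(t)},x^* )\qquad\text{with }\mu=\frac{\delta}{2}.$$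
   Context: $\mathbb{S}^{d-1}$ is the unit sphere of $\mathbb{R}^d$ with the Riemannian metric inherited from $\mathbb{R}^d$. The Riemannian gradient is $\mathrm{grad}f(x)=(I-xx^T)\nabla f(x)$ with $\nabla f(x)=-2Ax$. The exponential map is $\exp_p(v)=\cos(\|v\|)\,p+\sin(\|v\|)\frac{v}{\|v\|}$ for $0\ne v\in T_p\mathbb{S}^{d-1}$, $\exp_p(0)=p$. The intrinsic distance is $\mathrm{dist}(p,q)=\arccos\langle p,q\rangle$. *)

theory Defs
  imports "HOL-Analysis.Analysis" "HOL-Computational_Algebra.Polynomial"
begin

definition charpoly :: "real^'n^'n \<Rightarrow> real poly" where
  "charpoly A = det (mat [:0, 1:] - map_matrix (\<lambda>c. [:c:]) A)"

text \<open>The values \<open>l 1, \<dots>, l n\<close> are the eigenvalues repeated according to algebraic multiplicity;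
  the value of \<open>l\<close> at other indices is irrelevant.\<close>

definition ordered_eigenvalues :: "real^'n^'n \<Rightarrow> (nat \<Rightarrow> real) \<Rightarrow> bool" where
  "ordered_eigenvalues A l \<longleftrightarrow>
     charpoly A = (\<Prod>i = 1..CARD('n). [:- l i, 1:]) \<and> antimono_on {1..CARD('n)} l"

definition outer_prod :: "real^'n \<Rightarrow> real^'m \<Rightarrow> real^'m^'n" where
  "outer_prod x y = (\<chi> i j. x $ i * y $ j)"

definition gradient :: "('a::real_inner \<Rightarrow> real) \<Rightarrow> 'a \<Rightarrow> 'a" where
  "gradient f x = (THE D. GDERIV f x :> D)"

text \<open>Functions on the unit sphere are given by a smooth extension to the ambient space, and
  the following are meaningful only for points \<open>x\<close>, \<open>p\<close>, \<open>q\<close> with norm 1 and for \<open>v\<close> tangent at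
  \<open>p\<close>.\<close>

definition sphere_grad :: "(real^'n \<Rightarrow> real) \<Rightarrow> real^'n \<Rightarrow> real^'n" where
  "sphere_grad f x = (mat 1 - outer_prod x x) *v gradient f x"

definition sphere_exp :: "real^'n \<Rightarrow> real^'n \<Rightarrow> real^'n" where
  "sphere_exp p v =
     (if v = 0 then p else cos (norm v) *\<^sub>R p + sin (norm v) *\<^sub>R (v /\<^sub>R norm v))"

definition sphere_dist :: "real^'n \<Rightarrow> real^'n \<Rightarrow> real" where
  "sphere_dist p q = arccos (p \<bullet> q)"

definition neg_quad :: "real^'n^'n \<Rightarrow> real^'n \<Rightarrow> real" where
  "neg_quad A x = - (x \<bullet> (A *v x))"

definition sphere_cap :: "real^'n \<Rightarrow> real \<Rightarrow> (real^'n) set" where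
  "sphere_cap v a = {x \<in> sphere 0 1. x \<bullet> v \<ge> a}"

lemma gradient_eqI:
  fixes f :: "'a::real_inner \<Rightarrow> real"
  assumes "GDERIV f x :> D"
  shows "gradient f x = D"
  unfolding gradient_def
proof (rule the_equality)
  show "GDERIV f x :> D" by (rule assms)
next
  fix E assume "GDERIV f x :> E"
  then have "(\<lambda>h. h \<bullet> E) = (\<lambda>h. h \<bullet> D)"
    using assms has_derivative_unique unfolding gderiv_def by blast
  then have "h \<bullet> E = h \<bullet> D" for h
    by (rule fun_cong)
  then show "E = D"
    using vector_eq_ldot[of E D] by blast
qed

lemma gradient_neg_quad:
  fixes A :: "real^'n^'n"
  assumes "transpose A = A"
  shows "gradient (neg_quad A) x = - 2 *\<^sub>R (A *v x)"
proof (rule gradient_eqI)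
  have "((\<lambda>y. A *v y) has_derivative (\<lambda>h. A *v h)) (at x)"
    by (simp add: bounded_linear_imp_has_derivative matrix_vector_mul_bounded_linear)
  then have "((\<lambda>y. - (y \<bullet> (A *v y))) has_derivative (\<lambda>h. - (x \<bullet> (A *v h) + h \<bullet> (A *v x)))) (at x)"
    by (intro has_derivative_minus has_derivative_inner has_derivative_ident)
  moreover have "x \<bullet> (A *v h) = h \<bullet> (A *v x)" for h
    using dot_lmul_matrix[of x A h] transpose_matrix_vector[of A x] assms by (simp add: inner_commute)
  ultimately have "(neg_quad A has_derivative (\<lambda>h. - (h \<bullet> (A *v x) + h \<bullet> (A *v x)))) (at x)"
    by (simp add: neg_quad_def[abs_def])
  then show "GDERIV (neg_quad A) x :> - 2 *\<^sub>R (A *v x)"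
    by (simp add: gderiv_def)
qed

lemma outer_prod_mult_vec: "outer_prod x y *v z = (y \<bullet> z) *\<^sub>R x"
  by (simp add: vec_eq_iff outer_prod_def matrix_vector_mult_def inner_vec_def
      sum_distrib_left mult_ac)

lemma sphere_grad_tangent:
  assumes "x \<in> sphere 0 1"
  shows "x \<bullet> sphere_grad f x = 0"
  using assms
  by (simp add: sphere_grad_def matrix_vector_mult_diff_rdistrib outer_prod_mult_vec
      inner_diff_right dot_square_norm)

end

theory Submission
  imports Defs
begin

text \<open>Put \<open>\<theta> = dist(x, v\<^sub>1)\<close>, \<open>g = A x - \<rho> x\<close> with \<open>\<rho> = x \<bullet> A x\<close>, \<open>E = \<lambda>\<^sub>1 - \<rho>\<close>, and let \<open>s = 2\<eta> g\<close> be
  the step. On the nonnegatively curved sphere the distance after the step is at most the third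
  side of the Euclidean triangle with the same two sides and angle, which gives
  \<open>dist\<^sup>2(exp\<^sub>x s, v\<^sub>1) \<le> |s|\<^sup>2 + \<theta>\<^sup>2 - 2 (\<theta> / sin \<theta>) (s \<bullet> v\<^sub>1)\<close>, where \<open>s \<bullet> v\<^sub>1 = 2\<eta> E cos \<theta>\<close>.
  Since \<open>A\<^sup>2 \<le> \<lambda>\<^sub>1 A\<close>, the step satisfies \<open>|g|\<^sup>2 \<le> \<lambda>\<^sub>1 E\<close>, and as \<open>2\<eta>\<lambda>\<^sub>1 \<le> a \<le> cos \<theta>\<close> the quadratic term
  eats at most half of the linear one. The spectral gap gives \<open>E \<ge> \<delta> sin\<^sup>2 \<theta>\<close>, and
  \<open>sin \<theta> \<ge> \<theta> / 2\<close> turns what remains into a decrease of \<open>\<theta>\<^sup>2\<close> by \<open>a \<delta> \<eta> \<theta>\<^sup>2\<close>, twice what is claimed.\<close>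

section \<open>Geometric and algebraic multiplicity\<close>

lemma det_const_poly_matrix:
  fixes P :: "real^'n^'n"
  shows "det (map_matrix (\<lambda>c. [:c:]) P) = [:det P:]"
  unfolding det_def
  by (simp add: prod_to_poly sum_to_poly of_int_poly mult.commute)

text \<open>Multiplying the characteristic matrix by a basis that extends \<open>S\<close> makes the factor
  \<open>[:-k, 1:]\<close> appear in each of the \<open>card S\<close> lines that belong to eigenvectors.\<close>

lemma geometric_le_algebraic_multiplicity:
  fixes A :: "real^'n^'n"
  assumes ind: "independent S" and eig: "\<And>b. b \<in> S \<Longrightarrow> A *v b = k *\<^sub>R b"
  shows "[:- k, 1:] ^ card S dvd charpoly A"
proof -
  obtain B where B: "S \<subseteq> B" "independent B" and "UNIV \<subseteq> span B"
    by (rule maximal_independent_subset_extend[OF subset_UNIV ind])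
  then have spanB: "span B = UNIV" by (simp add: top.extremum_unique)
  have "finite B" using B(2) by (rule independent_imp_finite)
  have "card B = CARD('n)"
    using dim_eq_card_independent[OF B(2)] dim_span[of B] by (simp add: spanB)
  then obtain h where h: "bij_betw h (UNIV :: 'n set) B"
    using finite_same_card_bij[of "UNIV :: 'n set" B] \<open>finite B\<close> by auto
  \<comment> \<open>The rows of \<open>P\<close> are the basis vectors, so row \<open>i\<close> of
    the product with \<open>transpose X\<close> is the characteristic matrix applied to
    \<open>h i\<close>.\<close>
  define P :: "real^'n^'n" where "P = (\<chi> i. h i)"
  define X where "X = mat [:0, 1:] - map_matrix (\<lambda>c. [:c:]) A"
  define c where "c i = (if h i \<in> S then [:- k, 1:] else 1)" for i
  define R where "R = (\<chi> i. if h i \<in> S then map_matrix (\<lambda>c. [:c:]) P $ i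
    else (map_matrix (\<lambda>c. [:c:]) P ** transpose X) $ i)"
  have "rows P = B"
    using h by (auto simp: rows_def row_def P_def bij_betw_def)
  then have "det P \<noteq> 0"
    using spanB matrix_left_invertible_span_rows[of P] invertible_left_inverse invertible_det_nz by metis
  have entry: "(map_matrix (\<lambda>c. [:c:]) P ** transpose X) $ i $ j =
      [:0, 1:] * [:h i $ j:] - [:(A *v h i) $ j:]" for i j
  proof -
    have "(map_matrix (\<lambda>c. [:c:]) P ** transpose X) $ i $ j =
        (\<Sum>m\<in>UNIV. [:h i $ m:] * ((if j = m then [:0, 1:] else 0) - [:A $ j $ m:]))"
      by (simp add: matrix_matrix_mult_def transpose_def X_def P_def mat_def)
    also have "\<dots> = (\<Sum>m\<in>UNIV. (if j = m then [:0, 1:] * [:h i $ m:] else 0) - [:A $ j $ m * h i $ m:])"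
      by (intro sum.cong refl) (simp add: algebra_simps)
    also have "\<dots> = [:0, 1:] * [:h i $ j:] - [:(A *v h i) $ j:]"
      by (simp add: sum_subtractf sum_to_poly matrix_vector_mult_def)
    finally show ?thesis .
  qed
  have lines: "map_matrix (\<lambda>c. [:c:]) P ** transpose X = (\<chi> i. c i *s R $ i)"
  proof (simp add: vec_eq_iff, intro allI)
    fix i j
    show "(map_matrix (\<lambda>c. [:c:]) P ** transpose X) $ i $ j = c i * R $ i $ j"
    proof (cases "h i \<in> S")
      case True
      then show ?thesis by (simp add: entry c_def R_def eig) (simp add: P_def)
    next
      case False
      then show ?thesis by (simp add: c_def R_def)
    qed
  qed
  have "[:det P:] * det X = det (map_matrix (\<lambda>c. [:c:]) P ** transpose X)"
    by (simp only: det_const_poly_matrix det_mul det_transpose)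
  also have "\<dots> = det (\<chi> i. c i *s R $ i)"
    by (simp only: lines)
  also have "\<dots> = prod c UNIV * det R"
    by (simp add: det_rows_mul)
  also have "prod c UNIV = [:- k, 1:] ^ card S"
  proof -
    have "prod c UNIV = (\<Prod>b\<in>B. if b \<in> S then [:- k, 1:] else 1)"
      unfolding c_def by (rule prod.reindex_bij_betw[OF h])
    also have "\<dots> = (\<Prod>b\<in>S. [:- k, 1:])"
      using B(1) \<open>finite B\<close> by (simp add: prod.If_cases Int_absorb1)
    finally show ?thesis by simp
  qed
  finally have "[:- k, 1:] ^ card S dvd smult (det P) (charpoly A)"
    by (simp add: charpoly_def X_def)
  then show ?thesis
    using \<open>det P \<noteq> 0\<close> by (simp add: dvd_smult_iff)
qed

section \<open>Rayleigh quotient and spectral gap\<close>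

lemma symmetric_matrix_inner:
  fixes A :: "real^'n^'n"
  assumes "transpose A = A"
  shows "x \<bullet> (A *v y) = (A *v x) \<bullet> y"
  using assms dot_lmul_matrix[of x A y] transpose_matrix_vector[of A x] by simp

text \<open>The eigenvalue equation for \<open>u\<close> is the first-order condition at a maximum of the Rayleigh
  quotient on the unit sphere of \<open>v\<^sup>\<bottom>\<close>.\<close>

lemma symmetric_max_eigenvector_on_orthogonal:
  fixes A :: "real^'n^'n"
  assumes sym: "transpose A = A" and v: "A *v v = k *\<^sub>R v"
    and w: "norm w = 1" "w \<bullet> v = 0"
  obtains u \<kappa> where "norm u = 1" "u \<bullet> v = 0" "A *v u = \<kappa> *\<^sub>R u"
    "\<And>y. y \<bullet> v = 0 \<Longrightarrow> y \<bullet> (A *v y) \<le> \<kappa> * (norm y)\<^sup>2"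
proof -
  define K where "K = sphere 0 1 \<inter> {y. v \<bullet> y = 0}"
  have "compact K"
    unfolding K_def by (intro compact_Int_closed compact_sphere closed_hyperplane)
  moreover have "K \<noteq> {}"
    using w by (auto simp: K_def inner_commute)
  moreover have "continuous_on K (\<lambda>y. y \<bullet> (A *v y))"
    by (rule continuous_on_inner[OF continuous_on_id linear_continuous_on])
      (rule matrix_vector_mul_bounded_linear)
  ultimately obtain u where u: "u \<in> K" and max: "\<And>y. y \<in> K \<Longrightarrow> y \<bullet> (A *v y) \<le> u \<bullet> (A *v u)"
    using continuous_attains_sup[of K "\<lambda>y. y \<bullet> (A *v y)"] by auto
  define \<kappa> where "\<kappa> = u \<bullet> (A *v u)"
  have u1: "norm u = 1" and uv: "u \<bullet> v = 0"
    using u by (auto simp: K_def inner_commute)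
  have bound: "y \<bullet> (A *v y) \<le> \<kappa> * (norm y)\<^sup>2" if "y \<bullet> v = 0" for y
  proof (cases "y = 0")
    case False
    then have "y /\<^sub>R norm y \<in> K"
      using that by (simp add: K_def inner_commute)
    then have "(y /\<^sub>R norm y) \<bullet> (A *v (y /\<^sub>R norm y)) \<le> \<kappa>"
      unfolding \<kappa>_def by (rule max)
    then have "(y \<bullet> (A *v y)) / (norm y)\<^sup>2 \<le> \<kappa>"
      by (simp add: matrix_vector_mult_scaleR power2_eq_square divide_simps)
    then show ?thesis
      using False by (simp add: divide_simps)
  qed simp
  \<comment> \<open>The residual \<open>h\<close> is orthogonal to \<open>u\<close> by the choice of
    \<open>\<kappa>\<close> and to \<open>v\<close> by symmetry of \<open>A\<close>, so
    \<open>u + e *\<^sub>R h\<close> stays in the hyperplane.\<close>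
  define h where "h = A *v u - \<kappa> *\<^sub>R u"
  have hu: "h \<bullet> u = 0"
    using u1 by (simp add: h_def inner_diff_left \<kappa>_def inner_commute[of "A *v u"] norm_eq_1)
  have "v \<bullet> (A *v u) = 0"
    using uv by (simp add: symmetric_matrix_inner[OF sym, of v u] v inner_commute[of v u])
  then have hv: "h \<bullet> v = 0"
    using uv by (simp add: h_def inner_diff_right inner_commute)
  have hA: "h \<bullet> (A *v u) = (norm h)\<^sup>2" "u \<bullet> (A *v h) = (norm h)\<^sup>2"
  proof -
    have "A *v u = h + \<kappa> *\<^sub>R u" by (simp add: h_def)
    then show "h \<bullet> (A *v u) = (norm h)\<^sup>2"
      using hu by (simp add: inner_add_right dot_square_norm)
    then show "u \<bullet> (A *v h) = (norm h)\<^sup>2"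
      by (simp only: symmetric_matrix_inner[OF sym, of u h] inner_commute[of "A *v u" h])
  qed
  define C where "C = \<kappa> * (norm h)\<^sup>2 - h \<bullet> (A *v h)"
  \<comment> \<open>Maximality at \<open>u\<close> forces the second-order term
    \<open>e\<^sup>2 * C\<close> to absorb the first-order gain along \<open>h\<close>.\<close>
  have quad: "2 * (norm h)\<^sup>2 \<le> e * C" if "e > 0" for e
  proof -
    have "(u + e *\<^sub>R h) \<bullet> (A *v (u + e *\<^sub>R h)) \<le> \<kappa> * (norm (u + e *\<^sub>R h))\<^sup>2"
      using uv hv by (intro bound) (simp add: inner_add_left)
    moreover have "(norm (u + e *\<^sub>R h))\<^sup>2 = 1 + e\<^sup>2 * (norm h)\<^sup>2"
      using hu u1 by (simp add: power2_norm_eq_inner inner_add_left inner_add_right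
          inner_commute norm_eq_1) (simp add: power2_eq_square)
    moreover have "(u + e *\<^sub>R h) \<bullet> (A *v (u + e *\<^sub>R h)) =
        \<kappa> + 2 * e * (norm h)\<^sup>2 + e\<^sup>2 * (h \<bullet> (A *v h))"
      by (simp add: matrix_vector_right_distrib matrix_vector_mult_scaleR inner_add_left
          inner_add_right hA \<kappa>_def power2_eq_square distrib_left)
    ultimately have "e * (2 * (norm h)\<^sup>2) \<le> e * (e * C)"
      by (simp add: C_def algebra_simps power2_eq_square)
    then show ?thesis using that by simp
  qed
  have "h = 0"
  proof (rule ccontr)
    assume "h \<noteq> 0"
    define N where "N = (norm h)\<^sup>2"
    have "N > 0" using \<open>h \<noteq> 0\<close> by (simp add: N_def)
    have quadN: "2 * N \<le> e * C" if "e > 0" for e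
      using quad[OF that] by (simp add: N_def)
    have "C > 0" using quadN[of 1] \<open>N > 0\<close> by simp
    then have "2 * N \<le> N" using quadN[of "N / C"] \<open>N > 0\<close> by simp
    then show False using \<open>N > 0\<close> by simp
  qed
  then have "A *v u = \<kappa> *\<^sub>R u"
    by (simp add: h_def)
  then show ?thesis by (rule that[OF u1 uv _ bound])
qed

text \<open>A maximizer of the Rayleigh quotient on the complement of \<open>v\<close> is an
  eigenvector, so its value is some \<open>l i\<close>. It cannot be \<open>l 1\<close>: two
  independent eigenvectors would make \<open>l 1\<close> a double root, against the gap.\<close>

lemma rayleigh_le_second_eigenvalue:
  fixes A :: "real^'n^'n"
  assumes n2: "CARD('n) \<ge> 2" and sym: "transpose A = A" and ev: "ordered_eigenvalues A l"
    and gap: "l 2 < l 1" and v: "A *v v = l 1 *\<^sub>R v" "v \<noteq> 0"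
    and y: "y \<bullet> v = 0"
  shows "y \<bullet> (A *v y) \<le> l 2 * (norm y)\<^sup>2"
proof (cases "y = 0")
  case False
  then have "norm (y /\<^sub>R norm y) = 1" "(y /\<^sub>R norm y) \<bullet> v = 0"
    using y by simp_all
  then obtain u \<kappa> where u: "norm u = 1" "u \<bullet> v = 0" "A *v u = \<kappa> *\<^sub>R u"
    and bound: "\<And>y. y \<bullet> v = 0 \<Longrightarrow> y \<bullet> (A *v y) \<le> \<kappa> * (norm y)\<^sup>2"
    using symmetric_max_eigenvector_on_orthogonal[OF sym v(1)] by blast
  have cp: "charpoly A = (\<Prod>i = 1..CARD('n). [:- l i, 1:])"
    and anti: "antimono_on {1..CARD('n)} l"
    using ev by (auto simp: ordered_eigenvalues_def)
  have le2: "l i \<le> l 2" if "i \<in> {2..CARD('n)}" for i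
    using anti that n2 by (auto simp: monotone_on_def)
  have "u \<noteq> 0" using u(1) by auto
  have "independent {u}" using \<open>u \<noteq> 0\<close> by simp
  then have "[:- \<kappa>, 1:] ^ card {u} dvd charpoly A"
    by (rule geometric_le_algebraic_multiplicity) (simp add: u)
  then have "poly (charpoly A) \<kappa> = 0"
    by (simp add: poly_eq_0_iff_dvd)
  then obtain i where i: "i \<in> {1..CARD('n)}" "\<kappa> = l i"
    by (auto simp: cp poly_prod)
  have "\<kappa> \<noteq> l 1"
  proof
    assume "\<kappa> = l 1"
    have "u \<noteq> v" using u(2) \<open>v \<noteq> 0\<close> by auto
    have "independent {u, v}"
      using u(2) \<open>u \<noteq> 0\<close> \<open>v \<noteq> 0\<close>
      by (intro pairwise_orthogonal_independent)
        (auto simp: pairwise_def orthogonal_def inner_commute)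
    then have "[:- l 1, 1:] ^ card {u, v} dvd charpoly A"
      by (rule geometric_le_algebraic_multiplicity) (use u v \<open>\<kappa> = l 1\<close> in auto)
    \<comment> \<open>One factor is split off and cancelled, so the second one must come from an
      index at least 2.\<close>
    moreover have "charpoly A = [:- l 1, 1:] * (\<Prod>i = 2..CARD('n). [:- l i, 1:])"
      using n2 by (simp add: cp prod.atLeast_Suc_atMost numeral_2_eq_2)
    ultimately have "[:- l 1, 1:] * [:- l 1, 1:] dvd
        [:- l 1, 1:] * (\<Prod>i = 2..CARD('n). [:- l i, 1:])"
      using \<open>u \<noteq> v\<close> by (simp add: power2_eq_square)
    then have "[:- l 1, 1:] dvd (\<Prod>i = 2..CARD('n). [:- l i, 1:])"
      by (subst (asm) dvd_mult_cancel_left) simp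
    then have "poly (\<Prod>i = 2..CARD('n). [:- l i, 1:]) (l 1) = 0"
      by (simp add: poly_eq_0_iff_dvd)
    then obtain j where "j \<in> {2..CARD('n)}" "l j = l 1"
      by (auto simp: poly_prod)
    then show False using le2 gap by fastforce
  qed
  with i have "i \<in> {2..CARD('n)}"
    by (cases "i = 1") auto
  then have "\<kappa> \<le> l 2" using i le2 by simp
  then have "\<kappa> * (norm y)\<^sup>2 \<le> l 2 * (norm y)\<^sup>2"
    by (simp add: mult_right_mono)
  with bound[OF y] show ?thesis by simp
qed simp

text \<open>Splitting \<open>y\<close> along \<open>v\<close> and its complement leaves no cross
  term in the quadratic form, since \<open>v\<close> is an eigenvector; the Rayleigh bound is needed
  on the part \<open>r\<close> alone.\<close>

lemma spectral_gap_quadratic: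
  fixes A :: "real^'n^'n"
  assumes n2: "CARD('n) \<ge> 2" and sym: "transpose A = A" and ev: "ordered_eigenvalues A l"
    and gap: "l 2 < l 1" and v: "A *v v = l 1 *\<^sub>R v" "norm v = 1"
  shows "(l 1 - l 2) * ((norm y)\<^sup>2 - (y \<bullet> v)\<^sup>2) \<le> l 1 * (norm y)\<^sup>2 - y \<bullet> (A *v y)"
proof -
  define r where "r = y - (y \<bullet> v) *\<^sub>R v"
  have vv: "v \<bullet> v = 1" using v(2) by (simp add: norm_eq_1)
  have "r \<bullet> v = 0" by (simp add: r_def inner_diff_left vv)
  have "v \<noteq> 0" using v(2) by auto
  have "r \<bullet> (A *v r) \<le> l 2 * (norm r)\<^sup>2"
    by (rule rayleigh_le_second_eigenvalue[OF n2 sym ev gap v(1) \<open>v \<noteq> 0\<close> \<open>r \<bullet> v = 0\<close>])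
  moreover have "(norm y)\<^sup>2 = (norm r)\<^sup>2 + (y \<bullet> v)\<^sup>2"
    unfolding power2_norm_eq_inner
    by (simp add: r_def inner_diff_left inner_diff_right inner_commute vv power2_eq_square)
  moreover have "y \<bullet> (A *v y) = r \<bullet> (A *v r) + l 1 * (y \<bullet> v)\<^sup>2"
  proof -
    have "v \<bullet> (A *v y) = l 1 * (y \<bullet> v)"
      by (simp add: symmetric_matrix_inner[OF sym, of v y] v(1) inner_commute[of v y])
    then show ?thesis
      by (simp add: r_def matrix_vector_mult_diff_distrib matrix_vector_mult_scaleR v(1)
          inner_diff_left inner_diff_right vv power2_eq_square)
  qed
  ultimately show ?thesis by (simp add: algebra_simps)
qed

section \<open>Gram matrices and the Riemannian gradient\<close>

lemma gram_quadratic: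
  fixes M :: "real^'n^'m"
  shows "y \<bullet> ((transpose M ** M) *v z) = (M *v y) \<bullet> (M *v z)"
  using dot_lmul_matrix[of "M *v z" M y]
  by (simp add: matrix_vector_mul_assoc[symmetric] transpose_matrix_vector inner_commute)

text \<open>Cauchy-Schwarz for \<open>M *v z\<close> and \<open>M *v y\<close> with
  \<open>z = A *v y\<close>; the Rayleigh bound at \<open>z\<close> then lets one factor
  \<open>(norm z)\<^sup>2\<close> cancel.\<close>

lemma gram_norm_le:
  fixes M :: "real^'n^'m"
  assumes A: "A = transpose M ** M" and bound: "\<And>z. z \<bullet> (A *v z) \<le> k * (norm z)\<^sup>2"
  shows "(norm (A *v y))\<^sup>2 \<le> k * (y \<bullet> (A *v y))"
proof -
  define z where "z = A *v y"
  have "(norm z)\<^sup>2 = (M *v z) \<bullet> (M *v y)"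
    by (simp add: gram_quadratic[symmetric] A[symmetric] z_def[symmetric] dot_square_norm)
  then have "((norm z)\<^sup>2)\<^sup>2 \<le> (z \<bullet> (A *v z)) * (y \<bullet> (A *v y))"
    using Cauchy_Schwarz_ineq[of "M *v z" "M *v y"] by (simp add: A gram_quadratic)
  also have "\<dots> \<le> (k * (norm z)\<^sup>2) * (y \<bullet> (A *v y))"
    by (intro mult_right_mono bound) (simp add: A gram_quadratic)
  finally have "(norm z)\<^sup>2 * (norm z)\<^sup>2 \<le> (norm z)\<^sup>2 * (k * (y \<bullet> (A *v y)))"
    by (simp add: power2_eq_square algebra_simps)
  then have "z \<noteq> 0 \<Longrightarrow> (norm z)\<^sup>2 \<le> k * (y \<bullet> (A *v y))"
    by (rule mult_left_le_imp_le) simp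
  then show ?thesis
    by (cases "z = 0") (auto simp: z_def)
qed

lemma sphere_grad_neg_quad:
  fixes A :: "real^'n^'n"
  assumes "transpose A = A"
  shows "sphere_grad (neg_quad A) x = - 2 *\<^sub>R (A *v x - (x \<bullet> (A *v x)) *\<^sub>R x)"
  using gradient_neg_quad[OF assms, of x]
  by (simp add: sphere_grad_def matrix_vector_mult_diff_rdistrib outer_prod_mult_vec scaleR_diff_right)

section \<open>Comparison of spherical and Euclidean triangles\<close>

lemma mult_cos_le_sin:
  fixes x :: real
  assumes "0 \<le> x" "x \<le> pi"
  shows "x * cos x \<le> sin x"
proof -
  have "sin 0 - 0 * cos 0 \<le> sin x - x * cos x"
  proof (rule DERIV_nonneg_imp_nondecreasing[OF assms(1)])
    fix y assume y: "0 \<le> y" "y \<le> x"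
    have "((\<lambda>y. sin y - y * cos y) has_real_derivative y * sin y) (at y)"
      by (auto intro!: derivative_eq_intros)
    moreover have "0 \<le> y * sin y"
      using y assms by (simp add: sin_ge_zero)
    ultimately show "\<exists>d. ((\<lambda>y. sin y - y * cos y) has_real_derivative d) (at y) \<and> 0 \<le> d"
      by blast
  qed
  then show ?thesis by simp
qed

lemma sinc_antimono:
  fixes u w :: real
  assumes "0 < u" "u \<le> w" "w \<le> pi"
  shows "sin w / w \<le> sin u / u"
proof (rule DERIV_nonpos_imp_nonincreasing[OF assms(2)])
  fix x assume x: "u \<le> x" "x \<le> w"
  have "((\<lambda>x. sin x / x) has_real_derivative (cos x * x - sin x) / (x * x)) (at x)"
    using x assms by (auto intro!: derivative_eq_intros)
  moreover have "(cos x * x - sin x) / (x * x) \<le> 0"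
    using mult_cos_le_sin[of x] x assms by (simp add: divide_nonpos_nonneg mult.commute)
  ultimately show "\<exists>d. ((\<lambda>x. sin x / x) has_real_derivative d) (at x) \<and> d \<le> 0"
    by blast
qed

text \<open>The derivative of \<open>cos (sqrt t)\<close> is \<open>- sin u / (2 * u)\<close> at
  \<open>u = sqrt t\<close>, which increases because \<open>sin u / u\<close> decreases. Hence the
  function is convex up to \<open>pi\<^sup>2\<close>; the chord inequality has its denominators
  cleared.\<close>

lemma cos_sqrt_below_chord:
  fixes p w r :: real
  assumes "0 \<le> p" "p \<le> w" "w \<le> r" "r \<le> pi\<^sup>2"
  shows "(r - p) * cos (sqrt w) \<le> (r - w) * cos (sqrt p) + (w - p) * cos (sqrt r)"
proof -
  let ?c = "\<lambda>t. cos (sqrt t)" and ?d = "\<lambda>t. - sin (sqrt t) / (2 * sqrt t)"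
  \<comment> \<open>The mean value theorem needs differentiability only inside the interval, which
    admits the endpoint 0, where \<open>sqrt\<close> has no derivative.\<close>
  have mvt: "\<exists>z. s < z \<and> z < t \<and> ?c t - ?c s = (t - s) * ?d z" if "0 \<le> s" "s < t" for s t
  proof -
    have deriv: "(?c has_real_derivative ?d z) (at z)" if "0 < z" for z
      using that by (auto intro!: derivative_eq_intros simp: field_simps)
    have "continuous_on {s..t} ?c" by (intro continuous_intros)
    moreover have "?c differentiable (at z)" if "s < z" "z < t" for z
      using deriv[of z] that \<open>0 \<le> s\<close> real_differentiable_def by auto
    ultimately obtain m z where z: "s < z" "z < t" "(?c has_real_derivative m) (at z)"
      "?c t - ?c s = (t - s) * m"
      using MVT[OF \<open>s < t\<close>, of ?c] by blast
    moreover have "m = ?d z"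
      using DERIV_unique[OF z(3) deriv] z(1) \<open>0 \<le> s\<close> by simp
    ultimately show ?thesis by blast
  qed
  show ?thesis
  proof (cases "p < w \<and> w < r")
    case True
    obtain y where y: "p < y" "y < w" "?c w - ?c p = (w - p) * ?d y"
      using mvt[of p w] True assms by auto
    obtain z where z: "w < z" "z < r" "?c r - ?c w = (r - w) * ?d z"
      using mvt[of w r] True assms by auto
    have "sqrt z \<le> pi"
      using z assms real_le_lsqrt pi_ge_zero real_sqrt_le_iff by (smt (verit) real_sqrt_unique)
    then have "sin (sqrt z) / sqrt z \<le> sin (sqrt y) / sqrt y"
      using y z assms by (intro sinc_antimono) auto
    then have "?d y \<le> ?d z" by simp
    then have "(r - w) * ((w - p) * ?d y) \<le> (w - p) * ((r - w) * ?d z)"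
      using True mult_left_mono[of "?d y" "?d z" "(r - w) * (w - p)"]
      by (simp only: mult.assoc mult.left_commute) simp
    then have "(r - w) * (?c w - ?c p) \<le> (w - p) * (?c r - ?c w)"
      using y(3) z(3) by simp
    then show ?thesis by (simp add: algebra_simps)
  qed (use assms in auto)
qed

text \<open>For \<open>k = \<plusminus>1\<close> both sides agree, the right-hand side is affine in \<open>k\<close>, and the left-hand
  side is convex in \<open>k\<close>.\<close>

lemma cos_euclidean_le_cos_spherical:
  fixes b \<theta> k :: real
  assumes "0 < b" "0 < \<theta>" "b + \<theta> \<le> pi" "\<bar>k\<bar> \<le> 1"
  shows "cos (sqrt (b\<^sup>2 + \<theta>\<^sup>2 - 2 * b * \<theta> * k)) \<le> cos b * cos \<theta> + sin b * sin \<theta> * k"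
proof -
  let ?w = "b\<^sup>2 + \<theta>\<^sup>2 - 2 * b * \<theta> * k"
  have bk: "b * \<theta> * k \<le> b * \<theta>" "- (b * \<theta>) \<le> b * \<theta> * k"
    using assms mult_left_mono[of k 1 "b * \<theta>"] mult_left_mono[of "-1" k "b * \<theta>"] by auto
  \<comment> \<open>\<open>?w\<close> moves from the square of \<open>b - \<theta>\<close> to that
    of \<open>b + \<theta>\<close> as \<open>k\<close> falls from 1 to -1, and
    \<open>b + \<theta> \<le> pi\<close> keeps it where the chord bound applies.\<close>
  have "((b + \<theta>)\<^sup>2 - (b - \<theta>)\<^sup>2) * cos (sqrt ?w) \<le>
    ((b + \<theta>)\<^sup>2 - ?w) * cos (sqrt ((b - \<theta>)\<^sup>2)) + (?w - (b - \<theta>)\<^sup>2) * cos (sqrt ((b + \<theta>)\<^sup>2))"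
  proof (rule cos_sqrt_below_chord)
    show "(b - \<theta>)\<^sup>2 \<le> ?w" "?w \<le> (b + \<theta>)\<^sup>2"
      using bk by (simp_all add: power2_eq_square algebra_simps)
    show "(b + \<theta>)\<^sup>2 \<le> pi\<^sup>2"
      using assms by (intro power_mono) auto
  qed simp
  also have "cos (sqrt ((b - \<theta>)\<^sup>2)) = cos (b - \<theta>)" by simp
  also have "cos (sqrt ((b + \<theta>)\<^sup>2)) = cos (b + \<theta>)" by simp
  finally have "(4 * b * \<theta>) * cos (sqrt ?w) \<le> (4 * b * \<theta>) * (cos b * cos \<theta> + sin b * sin \<theta> * k)"
    by (simp add: cos_add cos_diff power2_eq_square algebra_simps)
  then show ?thesis using assms by simp
qed

text \<open>The spherical law of cosines gives the new inner product and the Euclidean one the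
  right-hand side, for the same sides \<open>norm s\<close>, \<open>\<theta>\<close> and the same
  angle at \<open>p\<close>; comparing the cosines orders the third sides.\<close>

lemma sphere_dist_exp_le:
  fixes p q s :: "real^'n"
  assumes p: "norm p = 1" and q: "norm q = 1" and tan: "p \<bullet> s = 0" and \<theta>: "\<theta> = sphere_dist p q"
    and \<theta>_pos: "0 < \<theta>" and sum_le: "norm s + \<theta> \<le> pi"
  shows "(sphere_dist (sphere_exp p s) q)\<^sup>2 \<le> (norm s)\<^sup>2 + \<theta>\<^sup>2 - 2 * (\<theta> / sin \<theta>) * (s \<bullet> q)"
proof (cases "s = 0")
  case True
  then show ?thesis by (simp add: sphere_exp_def \<theta>)
next
  case False
  define b where "b = norm s"
  have b: "b > 0" using False by (simp add: b_def)
  have "\<bar>p \<bullet> q\<bar> \<le> 1" using Cauchy_Schwarz_ineq2[of p q] p q by simp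
  then have cos: "cos \<theta> = p \<bullet> q" by (simp add: \<theta> sphere_dist_def)
  have "\<theta> < pi" using sum_le b unfolding b_def by linarith
  then have "sin \<theta> > 0" using \<theta>_pos by (intro sin_gt_zero)
  \<comment> \<open>\<open>k\<close> is the cosine of the angle at \<open>p\<close> between
    \<open>s\<close> and the geodesic to \<open>q\<close>, whose direction is
    \<open>q - cos \<theta> *\<^sub>R p\<close>, of length \<open>sin \<theta>\<close>.\<close>
  define k where "k = (s \<bullet> q) / (b * sin \<theta>)"
  have k: "s \<bullet> q = b * sin \<theta> * k" using b \<open>sin \<theta> > 0\<close> by (simp add: k_def)
  have "(norm (q - cos \<theta> *\<^sub>R p))\<^sup>2 = 1 - (cos \<theta>)\<^sup>2"
    using p q by (simp add: cos power2_norm_eq_inner inner_diff_left inner_diff_right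
        inner_commute norm_eq_1) (simp add: power2_eq_square)
  also have "\<dots> = (sin \<theta>)\<^sup>2" by (simp add: sin_squared_eq)
  finally have "norm (q - cos \<theta> *\<^sub>R p) = sin \<theta>"
    using \<open>sin \<theta> > 0\<close> by (simp add: power2_eq_iff_nonneg)
  moreover have "s \<bullet> q = s \<bullet> (q - cos \<theta> *\<^sub>R p)"
    using tan by (simp add: inner_diff_right inner_commute)
  ultimately have "\<bar>s \<bullet> q\<bar> \<le> b * sin \<theta>"
    using Cauchy_Schwarz_ineq2[of s "q - cos \<theta> *\<^sub>R p"] by (simp add: b_def)
  then have k1: "\<bar>k\<bar> \<le> 1"
    using b \<open>sin \<theta> > 0\<close> by (simp add: k_def abs_mult)
  define w where "w = b\<^sup>2 + \<theta>\<^sup>2 - 2 * b * \<theta> * k"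
  have bk: "\<bar>b * \<theta> * k\<bar> \<le> b * \<theta>"
    using b \<theta>_pos k1 by (simp add: abs_mult)
  have w0: "0 \<le> w"
    using bk sum_squares_bound[of b \<theta>] unfolding w_def by linarith
  have "- (b * \<theta> * k) \<le> b * \<theta>" using bk by linarith
  then have "w \<le> (b + \<theta>)\<^sup>2" by (simp add: w_def power2_sum mult_ac)
  also have "\<dots> \<le> pi\<^sup>2" using b \<theta>_pos sum_le by (intro power_mono) (auto simp: b_def)
  finally have wpi: "sqrt w \<le> pi" by (metis pi_ge_zero real_sqrt_abs real_sqrt_le_mono abs_of_nonneg)
  define z where "z = sphere_exp p s \<bullet> q"
  have z: "z = cos b * cos \<theta> + sin b * sin \<theta> * k"
    using False b by (simp add: z_def sphere_exp_def inner_add_left cos b_def[symmetric] k)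
  have cosw: "cos (sqrt w) \<le> z"
    unfolding z w_def using b \<theta>_pos sum_le k1
    by (intro cos_euclidean_le_cos_spherical) (auto simp: b_def)
  \<comment> \<open>Monotonicity of \<open>arccos\<close> requires arguments in [-1, 1]; this
    secures \<open>z \<le> 1\<close>, and \<open>cosw\<close> gives the lower end.\<close>
  have "\<bar>sin b * sin \<theta> * k\<bar> \<le> \<bar>sin b * sin \<theta>\<bar>"
    using k1 by (simp add: abs_mult mult_left_le)
  moreover have "\<bar>sin b * sin \<theta>\<bar> = sin b * sin \<theta>"
    using \<open>sin \<theta> > 0\<close> sin_ge_zero[of b] b sum_le \<theta>_pos by (simp add: b_def)
  ultimately have "z \<le> cos (b - \<theta>)" by (simp add: z cos_diff)
  then have "z \<le> 1" using cos_le_one order_trans by blast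
  have "arccos z \<le> arccos (cos (sqrt w))"
    using cosw \<open>z \<le> 1\<close> by (intro arccos_le_arccos) auto
  then have "arccos z \<le> sqrt w" using w0 wpi by (simp add: arccos_cos)
  moreover have "0 \<le> arccos z"
    using cosw \<open>z \<le> 1\<close> cos_ge_minus_one[of "sqrt w"] by (intro arccos_lbound) linarith+
  ultimately have "(arccos z)\<^sup>2 \<le> w" using w0 by (metis power_mono real_sqrt_pow2)
  moreover have "b * \<theta> * k = (\<theta> / sin \<theta>) * (s \<bullet> q)"
    using \<open>sin \<theta> > 0\<close> by (simp add: k)
  ultimately show ?thesis
    by (simp add: w_def z_def sphere_dist_def b_def)
qed

section \<open>Contraction of one gradient step\<close>

theorem proposition6:
  fixes M :: "real^'d^'m" and A :: "real^'d^'d" and l :: "nat \<Rightarrow> real"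
    and f :: "real^'d \<Rightarrow> real" and v\<^sub>1 x_star :: "real^'d" and x :: "nat \<Rightarrow> real^'d" and t :: nat
    and a \<gamma> \<eta> \<delta> \<mu> :: real
  assumes "CARD('d) \<ge> 2"
    and "A = transpose M ** M"
    and "ordered_eigenvalues A l"
    and "\<delta> = l 1 - l 2" and "\<delta> > 0"
    and "norm v\<^sub>1 = 1" and "A *v v\<^sub>1 = l 1 *\<^sub>R v\<^sub>1"
    and "x_star = v\<^sub>1"
    and "f = neg_quad A"
    and "a > 0"
    and "\<gamma> \<ge> 2 * l 1"
    and "0 < \<eta>" and "\<eta> \<le> a / \<gamma>"
    and "\<mu> = \<delta> / 2"
    and "x t \<in> sphere_cap v\<^sub>1 a"
    and "x (t + 1) = sphere_exp (x t) (- (\<eta> *\<^sub>R sphere_grad f (x t)))"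
  shows "(sphere_dist (x (t + 1)) x_star)\<^sup>2 \<le> (1 - a * \<mu> * \<eta>) * (sphere_dist (x t) x_star)\<^sup>2"
proof -
  note A = assms(2) and \<delta> = assms(4,5) and v = assms(6,7) and a = assms(10) and \<eta> = assms(12)
  define p where "p = x t"
  define c where "c = p \<bullet> v\<^sub>1"
  define \<rho> where "\<rho> = p \<bullet> (A *v p)"
  define g where "g = A *v p - \<rho> *\<^sub>R p"
  define s where "s = (2 * \<eta>) *\<^sub>R g"
  define \<theta> where "\<theta> = sphere_dist p v\<^sub>1"
  define E where "E = l 1 - \<rho>"
  have p: "norm p = 1" and ca: "a \<le> c"
    using assms(15) by (auto simp: sphere_cap_def p_def c_def)
  have pp: "p \<bullet> p = 1" using p by (simp add: norm_eq_1)
  have c1: "c \<le> 1" using Cauchy_Schwarz_ineq2[of p v\<^sub>1] p v by (simp add: c_def)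
  have sym: "transpose A = A"
    by (simp add: A matrix_transpose_mul)
  have x_next: "x (t + 1) = sphere_exp p s"
    using assms(16) by (simp add: assms(9) sphere_grad_neg_quad[OF sym] p_def s_def g_def \<rho>_def
        mult.commute)
  have gap: "\<delta> * ((norm y)\<^sup>2 - (y \<bullet> v\<^sub>1)\<^sup>2) \<le> l 1 * (norm y)\<^sup>2 - y \<bullet> (A *v y)" for y
    unfolding \<delta>(1) using \<delta> by (intro spectral_gap_quadratic[OF assms(1) sym assms(3) _ v(2,1)]) simp
  have bound: "y \<bullet> (A *v y) \<le> l 1 * (norm y)\<^sup>2" for y
  proof -
    have "(y \<bullet> v\<^sub>1)\<^sup>2 \<le> (norm y)\<^sup>2"
      using Cauchy_Schwarz_ineq2[of y v\<^sub>1] v by (simp add: abs_le_square_iff[symmetric])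
    then have "0 \<le> \<delta> * ((norm y)\<^sup>2 - (y \<bullet> v\<^sub>1)\<^sup>2)" using \<delta> by simp
    with gap[of y] show ?thesis by linarith
  qed
  have gapE: "\<delta> * (1 - c\<^sup>2) \<le> E"
    using gap[of p] by (simp add: E_def \<rho>_def c_def p)
  have E0: "0 \<le> E" using bound[of p] by (simp add: E_def \<rho>_def p)
  have \<rho>0: "0 \<le> \<rho>" by (simp add: \<rho>_def A gram_quadratic)
  have l0: "0 \<le> l 1" and \<rho>l: "\<rho> \<le> l 1" using E0 \<rho>0 by (auto simp: E_def)
  have tan: "p \<bullet> s = 0" by (simp add: s_def g_def inner_diff_right \<rho>_def pp)
  have "(A *v p) \<bullet> v\<^sub>1 = l 1 * c"
    using symmetric_matrix_inner[OF sym, of p v\<^sub>1] v by (simp add: c_def)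
  then have sv: "s \<bullet> v\<^sub>1 = 2 * \<eta> * (c * E)"
    by (simp add: s_def g_def inner_diff_left E_def c_def algebra_simps)
  \<comment> \<open>\<open>g\<close> is the tangential part of \<open>A *v p\<close>, so Pythagoras
    applies.\<close>
  have "(norm g)\<^sup>2 = (norm (A *v p))\<^sup>2 - \<rho>\<^sup>2"
    unfolding power2_norm_eq_inner
    by (simp add: g_def inner_diff_left inner_diff_right pp inner_commute[of "A *v p" p]
        \<rho>_def[symmetric] power2_eq_square)
  also have "\<dots> \<le> \<rho> * E"
    using gram_norm_le[OF A bound, of p] by (simp add: \<rho>_def[symmetric] E_def algebra_simps power2_eq_square)
  finally have g: "(norm g)\<^sup>2 \<le> \<rho> * E" .
  have g1: "(norm g)\<^sup>2 \<le> l 1 * E"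
    using g mult_right_mono[OF \<rho>l E0] by linarith
  \<comment> \<open>Two numbers with sum \<open>l 1\<close> have product at most
    \<open>(l 1 / 2)\<^sup>2\<close>. This keeps the step short enough for the triangle comparison,
    which asks for \<open>norm s + \<theta> \<le> pi\<close>.\<close>
  have "\<rho> * E \<le> (l 1 / 2)\<^sup>2"
    using zero_le_power2[of "\<rho> - l 1 / 2"] by (simp add: E_def power2_eq_square algebra_simps)
  with g have "(norm g)\<^sup>2 \<le> (l 1 / 2)\<^sup>2" by linarith
  then have g2: "norm g \<le> l 1 / 2" by (rule power2_le_imp_le) (use l0 in simp)
  \<comment> \<open>Division by zero yields 0, so this also excludes
    \<open>\<gamma> = 0\<close>.\<close>
  have "0 < a / \<gamma>" using assms(12,13) by linarith
  then have "\<gamma> > 0" using a by (simp add: zero_less_divide_iff)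
  then have "\<eta> * \<gamma> \<le> a" using assms(13) by (simp add: pos_le_divide_eq)
  moreover have "\<eta> * (2 * l 1) \<le> \<eta> * \<gamma>"
    using assms(11) \<eta> by (intro mult_left_mono) auto
  ultimately have \<eta>l: "2 * \<eta> * l 1 \<le> a" by (simp add: mult_ac)
  have "norm s \<le> 2 * \<eta> * (l 1 / 2)"
    using g2 \<eta> by (simp add: s_def)
  then have s_half: "norm s \<le> 1 / 2" using \<eta>l ca c1 by simp
  have \<theta>_arc: "\<theta> = arccos c" by (simp add: \<theta>_def sphere_dist_def c_def)
  have \<theta>0: "0 \<le> \<theta>" and cos: "cos \<theta> = c"
    using c1 a ca by (auto simp: \<theta>_arc arccos_lbound)
  have \<theta>pi: "\<theta> \<le> pi / 2"
    unfolding \<theta>_arc using c1 a ca by (intro arccos_le_pi2) auto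
  have "(sphere_dist (sphere_exp p s) v\<^sub>1)\<^sup>2 \<le> (1 - a * (\<delta> / 2) * \<eta>) * \<theta>\<^sup>2"
  proof (cases "\<theta> = 0")
    \<comment> \<open>The ratio \<open>\<theta> / sin \<theta>\<close> degenerates here, but
      \<open>p = v\<^sub>1\<close> is a fixed point of the step.\<close>
    case True
    then have "c = 1" using cos by simp
    then have "(norm (p - v\<^sub>1))\<^sup>2 = 0"
      using pp v(1) unfolding power2_norm_eq_inner
      by (simp add: inner_diff_left inner_diff_right inner_commute c_def norm_eq_1)
    then have "p = v\<^sub>1" by simp
    then have "\<rho> = l 1" "s = 0"
      using v pp by (simp_all add: \<rho>_def s_def g_def)
    then show ?thesis using True by (simp add: sphere_exp_def \<theta>_def)
  next
    case False
    with \<theta>0 have "\<theta> > 0" by simp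
    have "sin \<theta> > 0" using \<open>\<theta> > 0\<close> \<theta>pi by (intro sin_gt_zero) auto
    define K where "K = \<theta> / sin \<theta>"
    have "K \<ge> 1" using sin_x_le_x[OF \<theta>0] \<open>sin \<theta> > 0\<close> by (simp add: K_def)
    have "norm s + \<theta> \<le> pi" using s_half \<theta>pi pi_gt3 by linarith
    then have dist: "(sphere_dist (sphere_exp p s) v\<^sub>1)\<^sup>2 \<le> (norm s)\<^sup>2 + \<theta>\<^sup>2 - 2 * K * (s \<bullet> v\<^sub>1)"
      unfolding K_def by (rule sphere_dist_exp_le[OF p v(1) tan \<theta>_def \<open>\<theta> > 0\<close>])
    have cE: "0 \<le> c * E" using a ca E0 by simp
    \<comment> \<open>The target is half of the linear term
      \<open>2 * K * (s \<bullet> v\<^sub>1)\<close>, which equals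
      \<open>4 * \<eta> * (K * (c * E))\<close>.\<close>
    have "(norm s)\<^sup>2 = 4 * \<eta>\<^sup>2 * (norm g)\<^sup>2" by (simp add: s_def power_mult_distrib)
    also have "\<dots> \<le> 4 * \<eta>\<^sup>2 * (l 1 * E)" using g1 by (intro mult_left_mono) auto
    also have "\<dots> = 2 * \<eta> * ((2 * \<eta> * l 1) * E)" by (simp add: power2_eq_square)
    also have "\<dots> \<le> 2 * \<eta> * (c * E)"
      using \<eta> \<eta>l ca E0 by (intro mult_left_mono mult_right_mono) auto
    also have "\<dots> \<le> 2 * \<eta> * (K * (c * E))"
      using mult_right_mono[OF \<open>K \<ge> 1\<close> cE] \<eta> by (intro mult_left_mono) auto
    finally have s2: "(norm s)\<^sup>2 \<le> 2 * \<eta> * (K * (c * E))" .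
    \<comment> \<open>At the right end \<open>pi / 2\<close> the ratio is 2/pi, above 1/2 since pi <
      4.\<close>
    have "sin (pi / 2) / (pi / 2) \<le> sin \<theta> / \<theta>"
      using \<open>\<theta> > 0\<close> \<theta>pi by (intro sinc_antimono) auto
    moreover have "1 / 2 \<le> sin (pi / 2) / (pi / 2)"
      using pi_less_4 pi_gt_zero by (simp add: field_simps)
    ultimately have "1 / 2 \<le> sin \<theta> / \<theta>" by linarith
    then have sin_half: "\<theta> / 2 \<le> sin \<theta>" using \<open>\<theta> > 0\<close> by (simp add: field_simps)
    \<comment> \<open>Lower bound for the surviving half of the linear term: \<open>K\<close> turns
      the \<open>(sin \<theta>)\<^sup>2\<close> of the gap into
      \<open>\<theta> * sin \<theta>\<close>.\<close>
    have "a * (\<delta> * (\<theta> * (\<theta> / 2))) \<le> a * (\<delta> * (\<theta> * sin \<theta>))"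
      using a \<delta>(2) \<theta>0 sin_half by (intro mult_left_mono) auto
    also have "\<dots> = K * (a * (\<delta> * (1 - c\<^sup>2)))"
    proof -
      have "1 - c\<^sup>2 = (sin \<theta>)\<^sup>2" by (simp add: sin_squared_eq cos)
      moreover have "\<theta> = K * sin \<theta>" using \<open>sin \<theta> > 0\<close> by (simp add: K_def)
      ultimately show ?thesis by (simp add: power2_eq_square)
    qed
    also have "\<dots> \<le> K * (a * E)"
      using \<open>K \<ge> 1\<close> a gapE by (intro mult_left_mono) auto
    also have "\<dots> \<le> K * (c * E)"
      using \<open>K \<ge> 1\<close> ca E0 by (intro mult_left_mono mult_right_mono) auto
    finally have "2 * \<eta> * (a * (\<delta> * (\<theta> * (\<theta> / 2)))) \<le> 2 * \<eta> * (K * (c * E))"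
      using \<eta> by (intro mult_left_mono) auto
    with dist s2 have "(sphere_dist (sphere_exp p s) v\<^sub>1)\<^sup>2 \<le> \<theta>\<^sup>2 - a * \<delta> * \<eta> * \<theta>\<^sup>2"
      by (simp add: sv power2_eq_square algebra_simps)
    \<comment> \<open>Half of the decrease is given away to reach the rate with
      \<open>\<delta> / 2\<close>.\<close>
    moreover have "0 \<le> a * \<delta> * \<eta> * \<theta>\<^sup>2" using a \<delta>(2) \<eta> by simp
    ultimately show ?thesis by (simp add: algebra_simps)
  qed
  then show ?thesis
    by (simp only: x_next assms(8,14) \<theta>_def p_def)
qed

end
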